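(* The download cost for all users in the GroupRR mechanism is $$O\left(\log\frac ns\left(\frac{|E|}{s}+\frac{n^2}{s^2(e^{\varepsilon_1}-1)}\right)\right).$$
   Context: $G=(V,E)$ is a simple graph on users $v_1,\dots,v_n$, assumed sparse ($|E|$ much smaller than $|V|^2$); $a_{i,j}=1$ if $\{v_i,v_j\}\in E$ and $0$ otherwise. Parameters: a privacy budget $\varepsilon_1>0$, a positive integer $s$ (the sampling size), $p$ the smallest prime larger than $n$, $m=\lceil p/s\rceil$ (so $m\approx n/s$), and $\varepsilon'=\ln(1+s(e^{\varepsilon_1}-1))$. In the group randomized response step of the GroupRR mechanism, each user $v_i$ partitions the users, by the public random hash function $h_i(j)=((\theta_i j+\phi_i)\bmod p)\bmod m$ with $(\theta_i,\phi_i)$ drawn at random from $\{1,\dots,p-1\}\times\{0,\dots,p-1\}$, into $m$ groups $S_{i,t}=\{v_j:h_i(j)=t\}$, padded with dummy non-neighbours so that every group has size $s$, and draws from each group one representative $v_{c_t}$, each member being chosen with probability $1/s$. The bit $a_{i,c_t}$ (replaced by $0$ if $c_t>i$, and equal to $0$ for a dummy) is passed through randomized response: the published bit $a'_{i,c_t}$ equals the input bit with probability $\frac{e^{\varepsilon'}}{1+e^{\varepsilon'}}$ and its complement with probability $\frac{1}{1+e^{\varepsilon'}}$. User $v_i$'s message is the list of indices $\{t:a'_{i,c_t}=1\}$, encoded with $\log m\approx\log(n/s)$ bits per listed index. In the counting step each user must download the messages of all other users. The download cost is the average (expected) number of bits the server transmits to each user, i.e. the total size of these messages; the costs of the other steps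 are disregarded.
   Formalization: The bound is proved for n/s ≥ κ with any fixed κ > 1, the constant depending only on κ; without this it fails, e.g. for s = n the right-hand side is 0 because log(n/s) = 0 while the download cost is positive. *)

theory Defs
  imports "HOL-Probability.Probability" "HOL-Computational_Algebra.Primes"
begin

text \<open>Users are the numbers \<open>1, \<dots>, n\<close>; an edge is a two-element set of users.\<close>

definition simple_graph :: "nat \<Rightarrow> nat set set \<Rightarrow> bool" where
  "simple_graph n E \<longleftrightarrow> (\<forall>e\<in>E. e \<subseteq> {1..n} \<and> card e = 2)"

definition adj :: "nat set set \<Rightarrow> nat \<Rightarrow> nat \<Rightarrow> bool" where
  "adj E i j \<longleftrightarrow> {i, j} \<in> E"

definition next_prime :: "nat \<Rightarrow> nat" where
  "next_prime n = (LEAST p. prime p \<and> n < p)"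

definition num_groups :: "nat \<Rightarrow> nat \<Rightarrow> nat" where
  "num_groups n s = nat \<lceil>real (next_prime n) / real s\<rceil>"

definition hash :: "nat \<Rightarrow> nat \<Rightarrow> nat \<times> nat \<Rightarrow> nat \<Rightarrow> nat" where
  "hash n s = (\<lambda>(\<theta>, \<phi>) j. ((\<theta> * j + \<phi>) mod next_prime n) mod num_groups n s)"

definition hash_group :: "nat \<Rightarrow> nat \<Rightarrow> nat \<times> nat \<Rightarrow> nat \<Rightarrow> nat set" where
  "hash_group n s h t = {j \<in> {1..n}. hash n s h j = t}"

datatype member = User nat | Dummy nat

text \<open>The truncated subtraction is harmless: no group has more than \<open>s\<close> users
  (see \<open>card_padded_group\<close> below).\<close>

definition padded_group :: "nat \<Rightarrow> nat \<Rightarrow> nat \<times> nat \<Rightarrow> nat \<Rightarrow> member set" where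
  "padded_group n s h t =
     User ` hash_group n s h t \<union> Dummy ` {..<s - card (hash_group n s h t)}"

fun input_bit :: "nat set set \<Rightarrow> nat \<Rightarrow> member \<Rightarrow> bool" where
  "input_bit E i (User c) = (c \<le> i \<and> adj E i c)"
| "input_bit E i (Dummy d) = False"

definition randomized_response :: "real \<Rightarrow> bool \<Rightarrow> bool pmf" where
  "randomized_response \<epsilon> b =
     map_pmf (\<lambda>keep. if keep then b else \<not> b) (bernoulli_pmf (exp \<epsilon> / (1 + exp \<epsilon>)))"

text \<open>The privacy budget used on the representatives, enlarged to account for the sampling.\<close>

definition amplified_budget :: "nat \<Rightarrow> real \<Rightarrow> real" where
  "amplified_budget s \<epsilon> = ln (1 + real s * (exp \<epsilon> - 1))"

definition hash_params :: "nat \<Rightarrow> (nat \<times> nat) pmf" where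
  "hash_params n = pmf_of_set ({1..next_prime n - 1} \<times> {0..next_prime n - 1})"

definition published_bit ::
  "nat \<Rightarrow> nat \<Rightarrow> real \<Rightarrow> nat set set \<Rightarrow> nat \<Rightarrow> nat \<times> nat \<Rightarrow> nat \<Rightarrow> bool pmf" where
  "published_bit n s \<epsilon> E i h t =
     bind_pmf (pmf_of_set (padded_group n s h t))
       (\<lambda>c. randomized_response (amplified_budget s \<epsilon>) (input_bit E i c))"

definition user_message ::
  "nat \<Rightarrow> nat \<Rightarrow> real \<Rightarrow> nat set set \<Rightarrow> nat \<Rightarrow> nat list pmf" where
  "user_message n s \<epsilon> E i =
     bind_pmf (hash_params n) (\<lambda>h.
       map_pmf (\<lambda>a'. filter a' [0..<num_groups n s])
         (Pi_pmf {..<num_groups n s} False (published_bit n s \<epsilon> E i h)))"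

text \<open>The joint distribution of the messages of all users, who act independently.\<close>

definition group_rr ::
  "nat \<Rightarrow> nat \<Rightarrow> real \<Rightarrow> nat set set \<Rightarrow> (nat \<Rightarrow> nat list) pmf" where
  "group_rr n s \<epsilon> E = Pi_pmf {1..n} [] (user_message n s \<epsilon> E)"

text \<open>Each listed group index takes \<open>\<lceil>log 2 m\<rceil>\<close> bits, where \<open>m\<close> is the number of groups.\<close>

definition message_size :: "nat \<Rightarrow> nat \<Rightarrow> nat list \<Rightarrow> nat" where
  "message_size n s w = length w * nat \<lceil>log 2 (real (num_groups n s))\<rceil>"

definition download_cost :: "nat \<Rightarrow> nat \<Rightarrow> real \<Rightarrow> nat set set \<Rightarrow> nat \<Rightarrow> real" where
  "download_cost n s \<epsilon> E k =
     measure_pmf.expectation (group_rr n s \<epsilon> E)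
       (\<lambda>w. real (\<Sum>i\<in>{1..n} - {k}. message_size n s (w i)))"

lemma next_prime: "prime (next_prime n)" "n < next_prime n"
proof -
  obtain p :: nat where "prime p \<and> n < p"
    using bigger_prime by blast
  then have "prime (next_prime n) \<and> n < next_prime n"
    unfolding next_prime_def by (rule LeastI)
  then show "prime (next_prime n)" "n < next_prime n" by auto
qed

lemma card_hash_group_le:
  assumes "0 < s" and h: "h \<in> set_pmf (hash_params n)"
  shows "card (hash_group n s h t) \<le> s"
proof -
  define p where "p = next_prime n"
  define m where "m = num_groups n s"
  have p: "prime p" "n < p"
    using next_prime[of n] by (auto simp: p_def)
  have "real p / real s \<le> real m"
    unfolding m_def num_groups_def p_def by linarith
  then have "real p \<le> real (m * s)"
    using \<open>0 < s\<close> by (simp add: field_simps)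
  then have pms: "p \<le> m * s" by linarith
  then have m0: "m > 0" using p by (cases m) auto
  have "1 < p" using p(1) prime_gt_1_nat by blast
  then have "set_pmf (hash_params n) = {1..p - 1} \<times> {0..p - 1}"
    unfolding hash_params_def p_def[symmetric] by (subst set_pmf_of_set) auto
  then obtain \<theta> \<phi> where th: "h = (\<theta>, \<phi>)" "1 \<le> \<theta>" "\<theta> \<le> p - 1"
    using h by auto
  define f where "f j = (\<theta> * j + \<phi>) mod p" for j
  have cop: "coprime \<theta> p"
  proof -
    have "\<not> p dvd \<theta>"
      using th \<open>1 < p\<close> dvd_imp_le[of p \<theta>] by auto
    then show ?thesis
      using prime_imp_coprime[OF p(1)] by (simp add: coprime_commute)
  qed
  have inj: "inj_on f {1..n}"
  proof (rule linorder_inj_onI)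
    fix x y :: nat assume xy: "x < y" "x \<in> {1..n}" "y \<in> {1..n}"
    show "f x \<noteq> f y"
    proof
      assume "f x = f y"
      then have "p dvd (\<theta> * y + \<phi>) - (\<theta> * x + \<phi>)"
        using xy unfolding f_def by (subst mod_eq_dvd_iff_nat[symmetric]) auto
      then have "p dvd \<theta> * (y - x)"
        by (simp add: diff_mult_distrib2)
      then have "p dvd y - x"
        using cop by (simp add: coprime_commute coprime_dvd_mult_right_iff)
      then show False
        using xy p dvd_imp_le[of p "y - x"] by auto
    qed
  qed auto
  have fG: "f j div m < s \<and> f j mod m = t" if "j \<in> hash_group n s h t" for j
  proof -
    have "f j < p" using p by (simp add: f_def prime_gt_0_nat)
    then have "f j < s * m" using pms by (simp add: mult.commute)
    then have "f j div m < s" by (simp add: less_mult_imp_div_less)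
    moreover have "f j mod m = t"
      using that by (simp add: hash_group_def hash_def th f_def p_def m_def)
    ultimately show ?thesis by simp
  qed
  have "inj_on (\<lambda>j. f j div m) (hash_group n s h t)"
  proof (rule inj_onI)
    fix x y assume xy: "x \<in> hash_group n s h t" "y \<in> hash_group n s h t" "f x div m = f y div m"
    then have "f x = f y" using fG by (metis div_mult_mod_eq)
    moreover have "x \<in> {1..n}" "y \<in> {1..n}" using xy by (simp_all add: hash_group_def)
    ultimately show "x = y" using inj_onD[OF inj] by blast
  qed
  then have "card (hash_group n s h t) \<le> card {..<s}"
    by (rule card_inj_on_le) (use fG in auto)
  then show ?thesis by simp
qed

lemma card_padded_group:
  assumes "0 < s" and "h \<in> set_pmf (hash_params n)"
  shows "card (padded_group n s h t) = s"
proof -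
  have fin: "finite (hash_group n s h t)" by (simp add: hash_group_def)
  have "card (padded_group n s h t) = card (hash_group n s h t) + (s - card (hash_group n s h t))"
    unfolding padded_group_def
    by (subst card_Un_disjoint) (auto simp: fin card_image inj_on_def)
  then show ?thesis using card_hash_group_le[OF assms] by simp
qed

end

theory Submission
  imports Defs "HOL-Real_Asymp.Real_Asymp"
begin

text \<open>
  Since \<open>exp \<epsilon>' = 1 + s (exp \<epsilon>\<^sub>1 - 1)\<close>, randomized response turns a zero into a one with
  probability below \<open>1 / (s (exp \<epsilon>\<^sub>1 - 1))\<close>, and each edge adds at most \<open>1 / s\<close> to the expected
  number of listed indices, since it is an input of only one of its endpoints. So the expected
  number of indices is at most \<open>|E| / s + n m / (s (exp \<epsilon>\<^sub>1 - 1))\<close>. It remains to see that \<open>m\<close>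
  is \<open>O(n / s)\<close>, that is, that the next prime after \<open>n\<close> is \<open>O(n)\<close>. This weak form of Bertrand's
  postulate follows from Chebyshev's argument: if there were no prime in \<open>(n, 4 n]\<close>, then all
  numbers up to \<open>4 n\<close> would have a common multiple \<open>L\<close> of size \<open>4\<^sup>n\<close> up to subexponential factors,
  whereas \<open>L\<close> must be at least \<open>2 n (4 n choose 2 n) \<ge> 16\<^sup>n / 2\<close>.
\<close>

subsection \<open>A linear bound on the next prime\<close>

text \<open>Row \<open>N\<close> at column \<open>k + 1\<close> rests on rows \<open>N - 1\<close>
  and \<open>N\<close> at column \<open>k\<close>, hence the induction on \<open>k\<close> with
  \<open>N\<close> arbitrary. Taken at the middle of the row, this forces every common multiple of
  1, ..., \<open>N\<close> to be exponentially large.\<close>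

lemma mult_binomial_dvd:
  fixes L :: nat
  assumes "\<And>j. 0 < j \<Longrightarrow> j \<le> N \<Longrightarrow> j dvd L" and "0 < k" and "k \<le> N"
  shows "k * (N choose k) dvd L"
  using assms
proof (induction k arbitrary: N)
  case 0
  then show ?case by simp
next
  case (Suc k)
  show ?case
  proof (cases "k = 0")
    case True
    then show ?thesis using Suc.prems by auto
  next
    case False
    obtain M where M: "N = Suc M" using Suc.prems(3) by (cases N) auto
    define x where "x = M choose k"
    obtain u where u: "L = k * x * u"
      using Suc.IH[of M] Suc.prems M False unfolding x_def dvd_def by auto
    obtain v where v: "L = k * (N choose k) * v"
      using Suc.IH[of N] Suc.prems False unfolding dvd_def by auto
    have c: "Suc k * (N choose Suc k) = N * x"
      unfolding M x_def by (metis Suc_times_binomial_eq mult.commute)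
    have "(N - k) * (N choose k) = N * x"
      using binomial_absorb_comp[of N k] unfolding M x_def by simp
    then have b: "(int N - int k) * int (N choose k) = int N * int x"
      using Suc.prems(3) by (metis Suc_leD of_nat_diff of_nat_mult)
    \<comment> \<open>Leibniz's harmonic triangle: \<open>1 / ((k + 1) (N choose k + 1)) = 1 / (k (N - 1 choose k)) - 1 / (k (N choose k))\<close>\<close>
    have "int k * (int N * int x * (int u - int v)) =
        int N * int (k * x * u) - int k * int v * (int N * int x)"
      by (simp add: algebra_simps)
    also have "\<dots> = int N * int (k * x * u) - (int N - int k) * int (k * (N choose k) * v)"
      unfolding b[symmetric] by (simp add: algebra_simps)
    also have "\<dots> = int k * int L"
      unfolding u[symmetric] v[symmetric] by (simp add: algebra_simps)
    finally have "int L = int (N * x) * (int u - int v)" using False by simp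
    then have "int (N * x) dvd int L" by (rule dvdI)
    then show ?thesis unfolding c by (simp only: of_nat_dvd_iff)
  qed
qed

lemma prod_primes_dvd:
  fixes x :: nat
  assumes "finite U" "\<And>p. p \<in> U \<Longrightarrow> prime p" "\<And>p. p \<in> U \<Longrightarrow> p dvd x"
  shows "\<Prod>U dvd x"
  using assms
proof (induction U rule: finite_induct)
  case (insert p U)
  have "coprime p (\<Prod>U)"
    using insert by (intro prod_coprime_right) (auto intro: primes_coprime)
  then show ?case using insert by (auto intro: divides_mult)
qed simp

text \<open>Erdos's induction. An even \<open>n > 2\<close> adds no prime. For
  \<open>n = 2 * m + 1\<close>, the primes above \<open>m + 1\<close> all divide
  \<open>n choose m\<close>, which is at most \<open>4 ^ m\<close>, and the remaining ones fall
  under the induction hypothesis at \<open>m + 1\<close>.\<close>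

lemma prod_primes_le_four_power: "\<Prod>{p::nat. prime p \<and> p \<le> n} \<le> 4 ^ n"
proof (induction n rule: less_induct)
  case (less n)
  have fin: "finite {p. prime p \<and> p \<le> x}" for x :: nat by simp
  consider "n = 0" | "n = 1" | "n = 2" | m where "n = 2 * m" "m > 1" | m where "n = 2 * m + 1" "m > 0"
    by (metis One_nat_def Suc_eq_plus1 evenE gr0I less_one linorder_neqE_nat mult_0_right mult.right_neutral oddE)
  then show ?case
  proof cases
    case 1
    then have "{p::nat. prime p \<and> p \<le> n} = {}" by (auto dest: prime_gt_0_nat)
    then show ?thesis by (simp only: prod.empty) simp
  next
    case 2
    then have "{p::nat. prime p \<and> p \<le> n} = {}" by (auto dest: prime_gt_1_nat)
    then show ?thesis by (simp only: prod.empty) simp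
  next
    case 3
    then have "{p::nat. prime p \<and> p \<le> n} = {2}" by (auto dest: prime_gt_1_nat)
    then show ?thesis using 3 by simp
  next
    case (4 m)
    then have "\<not> prime n" using prime_product[of 2 m] by auto
    then have "{p::nat. prime p \<and> p \<le> n} = {p::nat. prime p \<and> p \<le> n - 1}"
      by (auto simp: le_less)
    then have "\<Prod>{p::nat. prime p \<and> p \<le> n} \<le> 4 ^ (n - 1)" using less.IH[of "n - 1"] 4 by simp
    also have "\<dots> \<le> 4 ^ n" by (intro power_increasing) auto
    finally show ?thesis .
  next
    case (5 m)
    define U where "U = {p::nat. prime p \<and> m + 1 < p \<and> p \<le> n}"
    have "\<Prod>U dvd n choose m"
    proof -
      have "p dvd n choose m" if "p \<in> U" for p
      proof -
        have p: "prime p" "m + 1 < p" "p \<le> n" using that by (auto simp: U_def)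
        have "p dvd fact n" using p by (simp only: prime_dvd_fact_iff)
        also have "fact n = fact m * fact (m + 1) * (n choose m)"
          using binomial_fact_lemma[of m n] 5 by (simp only:) simp
        \<comment> \<open>A prime above \<open>m + 1\<close> divides neither of the two factorials,
          so it divides the binomial coefficient.\<close>
        finally show ?thesis
          using p by (auto simp only: prime_dvd_mult_iff prime_dvd_fact_iff)
      qed
      then show ?thesis by (intro prod_primes_dvd) (auto simp: U_def)
    qed
    then have "\<Prod>U \<le> n choose m" using 5 by (intro dvd_imp_le) auto
    also have "\<dots> \<le> 4 ^ m"
    proof -
      \<comment> \<open>The two middle entries of row \<open>2 * m + 1\<close> are equal, so each is
        at most half the row sum.\<close>
      have "(n choose m) + (n choose (m + 1)) = (\<Sum>k\<in>{m, m + 1}. n choose k)" by simp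
      also have "\<dots> \<le> (\<Sum>k\<le>n. n choose k)" using 5 by (intro sum_mono2) auto
      also have "\<dots> = 2 * 4 ^ m" unfolding choose_row_sum using 5 by (simp add: power_mult)
      finally show ?thesis using binomial_symmetric[of m n] 5 by simp
    qed
    finally have U: "\<Prod>U \<le> 4 ^ m" .
    have "{p::nat. prime p \<and> p \<le> n} = {p. prime p \<and> p \<le> m + 1} \<union> U"
      using 5 by (auto simp: U_def)
    moreover have "{p. prime p \<and> p \<le> m + 1} \<inter> U = {}" "finite U" by (auto simp: U_def)
    ultimately have "\<Prod>{p::nat. prime p \<and> p \<le> n} = \<Prod>{p. prime p \<and> p \<le> m + 1} * \<Prod>U"
      using prod.union_disjoint[of "{p. prime p \<and> p \<le> m + 1}" U "\<lambda>p. p"] fin by (simp only:)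
    also have "\<dots> \<le> 4 ^ (m + 1) * 4 ^ m" using U less.IH[of "m + 1"] 5 by (intro mult_mono) auto
    also have "\<dots> = 4 ^ n" using 5 by (simp add: power_add[symmetric] mult_2)
    finally show ?thesis .
  qed
qed

lemma prime_between:
  "eventually (\<lambda>n. \<exists>p::nat. prime p \<and> n < p \<and> p \<le> 4 * n) at_top"
proof -
  \<comment> \<open>The logarithm of \<open>2 * N powr sqrt N < 4 ^ n\<close> for
    \<open>N = 4 * n\<close>, the inequality that the final size comparison contradicts.\<close>
  have "eventually (\<lambda>n. ln 2 + sqrt (real (4 * n)) * ln (real (4 * n)) < real n * ln 4) at_top"
    by real_asymp
  then show ?thesis
    using eventually_gt_at_top[of 0]
  proof eventually_elim
    case (elim n)
    define N where "N = 4 * n"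
    have N: "N > 0" using elim by (simp add: N_def)
    have "2 * real N powr sqrt (real N) = exp (ln 2 + sqrt (real N) * ln (real N))"
      using N by (simp add: powr_def exp_add)
    also have "\<dots> < exp (real n * ln 4)" using elim by (simp add: N_def)
    also have "\<dots> = 4 ^ n" by (simp add: exp_of_nat_mult)
    finally have subexp: "2 * real N powr sqrt (real N) < 4 ^ n" .
    define r where "r = nat \<lfloor>sqrt (real N)\<rfloor>"
    have small: "p \<le> r" if "p * p \<le> N" for p :: nat
    proof -
      have "real p \<le> sqrt (real N)"
        using that by (intro real_le_rsqrt) (simp add: power2_eq_square flip: of_nat_mult)
      then show ?thesis unfolding r_def by linarith
    qed
    define e where "e p = Max {k. p ^ k \<le> N}" for p :: nat
    have fin: "finite {k. p ^ k \<le> N}" if "prime p" for p :: nat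
    proof (rule finite_subset)
      show "{k. p ^ k \<le> N} \<subseteq> {..N}"
      proof safe
        fix k assume "p ^ k \<le> N"
        moreover have "k < 2 ^ k" by simp
        moreover have "2 ^ k \<le> p ^ k" using prime_ge_2_nat[OF that] by (intro power_mono) auto
        ultimately show "k \<le> N" by linarith
      qed
    qed simp
    have e: "p ^ e p \<le> N" if "prime p" for p
    proof -
      have "0 \<in> {k. p ^ k \<le> N}" using N by simp
      then show ?thesis using Max_in[OF fin[OF that]] unfolding e_def by blast
    qed
    have le_e: "k \<le> e p" if "prime p" "p ^ k \<le> N" for p k
      unfolding e_def using that by (intro Max_ge fin) auto
    define A where "A = {p::nat. prime p \<and> p \<le> r}"
    define B where "B = {p::nat. prime p \<and> p \<le> n}"
    \<comment> \<open>Primes up to the square root of \<open>N\<close> get their largest power not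
      exceeding \<open>N\<close>; above it the first power suffices. \<open>B\<close> may repeat
      primes of \<open>A\<close>: this only enlarges \<open>L\<close> and leaves
      \<open>\<Prod>B\<close> in the form bounded by \<open>4 ^ n\<close>.\<close>
    define L where "L = (\<Prod>p\<in>A. p ^ e p) * \<Prod>B"
    have AB: "finite A" "finite B" by (auto simp: A_def B_def)
    have L0: "L \<noteq> 0" using AB by (auto simp: L_def A_def B_def)
    show ?case
    proof (rule ccontr)
      assume no: "\<not> ?case"
      have "j dvd L" if j: "0 < j" "j \<le> N" for j
      proof (rule multiplicity_le_imp_dvd)
        fix p :: nat assume p: "prime p"
        define k where "k = multiplicity p j"
        have pk: "p ^ k dvd j" unfolding k_def by (rule multiplicity_dvd)
        then have pkN: "p ^ k \<le> N" using j dvd_imp_le[OF pk] by linarith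
        have "p ^ k dvd L"
        proof (cases "p \<in> A")
          case True
          then have "p ^ e p dvd (\<Prod>p\<in>A. p ^ e p)" using AB by (intro dvd_prodI)
          then show ?thesis using le_e[OF p pkN] unfolding L_def
            by (intro dvd_mult2) (rule dvd_trans[OF le_imp_power_dvd])
        next
          case False
          then have "\<not> p * p \<le> N" using small p by (auto simp: A_def)
          then have k1: "k < 2" using pkN power_increasing[of 2 k p] prime_ge_1_nat[OF p]
            by (cases "2 \<le> k") (simp_all add: power2_eq_square)
          show ?thesis
          proof (cases k)
            case (Suc k')
            then have "k = 1" using k1 by simp
            \<comment> \<open>The absence of primes in (n, 4n] enters here: \<open>p\<close> is at
              most \<open>N\<close>, hence at most \<open>n\<close>.\<close>
            then have "p \<in> B" using pkN p no by (cases "p \<le> n") (auto simp: B_def N_def)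
            then have "p dvd \<Prod>B" using AB dvd_prodI[of B p "\<lambda>x. x"] by simp
            then show ?thesis using \<open>k = 1\<close> by (simp add: L_def)
          qed simp
        qed
        then show "multiplicity p j \<le> multiplicity p L"
          unfolding k_def using p L0 by (intro multiplicity_geI) auto
      qed (use j in auto)
      then have "2 * n * (N choose (2 * n)) dvd L"
        using elim by (intro mult_binomial_dvd) (auto simp: N_def)
      then have "2 * n * (N choose (2 * n)) \<le> L" using L0 by (intro dvd_imp_le) auto
      then have "real (2 * n * (N choose (2 * n))) \<le> real L" by (simp only: of_nat_le_iff)
      then have "2 * real n * real (N choose (2 * n)) \<le> real L"
        by (simp only: of_nat_mult of_nat_numeral)
      \<comment> \<open>The central coefficient is at least \<open>4 ^ (2 * n) / (4 * n)\<close>;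
        the factor \<open>2 * n\<close> recovers the denominator up to 2.\<close>
      moreover have "4 ^ (2 * n) \<le> 2 * (2 * real n * real (N choose (2 * n)))"
        using central_binomial_lower_bound[of "2 * n"] elim by (simp add: N_def field_simps)
      ultimately have "4 ^ (2 * n) \<le> 2 * real L" by linarith
      moreover have "real L \<le> real N powr sqrt (real N) * 4 ^ n"
      proof -
        have "(\<Prod>p\<in>A. p ^ e p) \<le> (\<Prod>p\<in>A. N)" by (intro prod_mono) (use e in \<open>auto simp: A_def\<close>)
        also have "\<dots> \<le> N ^ r"
        proof -
          have "card A \<le> card {1..r}" by (intro card_mono) (auto simp: A_def Suc_le_eq prime_gt_0_nat)
          then show ?thesis using N by (simp add: power_increasing)
        qed
        finally have "L \<le> N ^ r * 4 ^ n"
          unfolding L_def B_def using prod_primes_le_four_power by (rule mult_mono) auto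
        then have "real L \<le> real (N ^ r * 4 ^ n)" using of_nat_le_iff by blast
        then have "real L \<le> real N ^ r * 4 ^ n" by simp
        also have "real N ^ r = real N powr real r" using N by (simp add: powr_realpow)
        also have "\<dots> \<le> real N powr sqrt (real N)" using N unfolding r_def by (intro powr_mono) auto
        finally show ?thesis by simp
      qed
      ultimately have "4 ^ (2 * n) \<le> (2 * real N powr sqrt (real N)) * 4 ^ n" by simp
      also have "\<dots> < 4 ^ n * 4 ^ n" using subexp by (intro mult_strict_right_mono) auto
      finally show False by (simp add: power_add[symmetric] mult_2)
    qed
  qed
qed

lemma next_prime_linear_bound: "\<exists>K>0. \<forall>n>0. real (next_prime n) \<le> K * real n"
proof -
  obtain n0 :: nat where n0: "\<And>n. n0 \<le> n \<Longrightarrow> \<exists>p::nat. prime p \<and> n < p \<and> p \<le> 4 * n"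
    using prime_between unfolding eventually_at_top_linorder by blast
  \<comment> \<open>\<open>M\<close> dominates the next primes below the threshold
    \<open>n0\<close>, and \<open>M \<le> M * n\<close> because \<open>n > 0\<close>.\<close>
  define M where "M = (\<Sum>n<n0. next_prime n)"
  have "next_prime n \<le> (4 + M) * n" if "n > 0" for n
  proof (cases "n < n0")
    case True
    then have "next_prime n \<le> M" unfolding M_def by (intro member_le_sum) auto
    also have "\<dots> \<le> M * n" using that by simp
    finally show ?thesis by (simp add: distrib_right)
  next
    case False
    then obtain p where "prime p" "n < p" "p \<le> 4 * n" using n0[of n] by auto
    then have "next_prime n \<le> 4 * n" unfolding next_prime_def
      using Least_le[of "\<lambda>p. prime p \<and> n < p" p] by linarith
    then show ?thesis by (simp add: distrib_right)
  qed
  then have "\<forall>n>0. real (next_prime n) \<le> real (4 + M) * real n"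
    by (metis of_nat_le_iff of_nat_mult)
  then show ?thesis by (intro exI[of _ "real (4 + M)"]) auto
qed

subsection \<open>The expected message length\<close>

text \<open>A zero is flipped with probability \<open>1 / (1 + exp \<epsilon>)\<close>, and a one
  costs at most 1. The additive form allows noise and edges to be summed separately.\<close>

lemma pmf_randomized_response_True_le:
  "pmf (randomized_response \<epsilon> b) True \<le> exp (- \<epsilon>) + of_bool b"
proof -
  let ?q = "exp \<epsilon> / (1 + exp \<epsilon>)"
  have q: "0 \<le> ?q" "?q \<le> 1" by (auto simp: add_pos_pos divide_simps)
  have "pmf (randomized_response \<epsilon> b) True = (if b then ?q else 1 - ?q)"
  proof (cases b)
    case True
    then have "randomized_response \<epsilon> b = bernoulli_pmf ?q"
      by (simp add: randomized_response_def map_pmf_idI)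
    then show ?thesis using True q by simp
  next
    case False
    then have "pmf (randomized_response \<epsilon> b) (\<not> False) = pmf (bernoulli_pmf ?q) False"
      unfolding randomized_response_def
      by (subst pmf_map_inj'[symmetric, of Not]) (auto simp: inj_def)
    then show ?thesis using False q by simp
  qed
  moreover have "1 - ?q \<le> exp (- \<epsilon>)"
  proof -
    have "1 + exp \<epsilon> > 0" by (simp add: add_pos_pos)
    then show ?thesis by (simp add: exp_minus field_simps)
  qed
  ultimately show ?thesis using q by (auto intro: add_increasing)
qed

lemma exp_minus_amplified_budget_le:
  assumes "0 < s" "0 < \<epsilon>"
  shows "exp (- amplified_budget s \<epsilon>) \<le> 1 / (real s * (exp \<epsilon> - 1))"
proof -
  have "real s * (exp \<epsilon> - 1) > 0" using assms by simp
  then show ?thesis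
    unfolding amplified_budget_def exp_minus by (simp add: inverse_eq_divide field_simps)
qed

text \<open>The padded group has exactly \<open>s\<close> members, drawn uniformly. Averaging leaves
  the common noise term unchanged and gives weight \<open>1 / s\<close> to each member whose input
  bit is one; dummies contribute noise only.\<close>

lemma pmf_published_bit_le:
  assumes "0 < s" "0 < \<epsilon>" "h \<in> set_pmf (hash_params n)"
  shows "pmf (published_bit n s \<epsilon> E i h t) True \<le>
    1 / (real s * (exp \<epsilon> - 1)) + real (card {j \<in> hash_group n s h t. j \<le> i \<and> adj E i j}) / real s"
proof -
  define G where "G = padded_group n s h t"
  define q where "q = 1 / (real s * (exp \<epsilon> - 1))"
  have G: "card G = s" unfolding G_def by (rule card_padded_group) fact+
  then have finG: "finite G" "G \<noteq> {}" using assms by (auto intro: card_ge_0_finite)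
  have "pmf (published_bit n s \<epsilon> E i h t) True =
      (\<Sum>c\<in>G. pmf (randomized_response (amplified_budget s \<epsilon>) (input_bit E i c)) True) / real s"
    unfolding published_bit_def G_def[symmetric] using finG G by (simp add: pmf_bind_pmf_of_set)
  also have "\<dots> \<le> (\<Sum>c\<in>G. q + of_bool (input_bit E i c)) / real s"
  proof (intro divide_right_mono sum_mono)
    fix c
    show "pmf (randomized_response (amplified_budget s \<epsilon>) (input_bit E i c)) True \<le> q + of_bool (input_bit E i c)"
      using pmf_randomized_response_True_le[of "amplified_budget s \<epsilon>" "input_bit E i c"]
        exp_minus_amplified_budget_le[OF assms(1,2)] unfolding q_def by linarith
  qed simp
  also have "\<dots> = q + real (card {c \<in> G. input_bit E i c}) / real s"
    using assms finG G by (simp add: sum.distrib add_divide_distrib Int_def)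
  also have "{c \<in> G. input_bit E i c} = User ` {j \<in> hash_group n s h t. j \<le> i \<and> adj E i j}"
    by (auto simp: G_def padded_group_def)
  also have "card \<dots> = card {j \<in> hash_group n s h t. j \<le> i \<and> adj E i j}"
    by (rule card_image) (auto simp: inj_on_def)
  finally show ?thesis by (simp add: q_def)
qed

lemma num_groups_pos: "0 < s \<Longrightarrow> 0 < num_groups n s"
  using next_prime(2)[of n] by (simp add: num_groups_def)

text \<open>The hash groups are disjoint, so a neighbour is counted in at most one of them.\<close>

lemma sum_pmf_published_bit_le:
  assumes "0 < s" "0 < \<epsilon>" "h \<in> set_pmf (hash_params n)"
  shows "(\<Sum>t<num_groups n s. pmf (published_bit n s \<epsilon> E i h t) True) \<le>
    real (num_groups n s) / (real s * (exp \<epsilon> - 1)) + real (card {j \<in> {1..n}. j \<le> i \<and> adj E i j}) / real s"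
proof -
  let ?m = "num_groups n s" and ?N = "{j \<in> {1..n}. j \<le> i \<and> adj E i j}"
  have "(\<Sum>t<?m. card {j \<in> hash_group n s h t. j \<le> i \<and> adj E i j}) =
      (\<Sum>t<?m. card {j \<in> ?N. hash n s h j = t})"
    by (intro sum.cong arg_cong[where f = card]) (auto simp: hash_group_def)
  also have "\<dots> = card (\<Union>t<?m. {j \<in> ?N. hash n s h j = t})"
    by (rule card_UN_disjoint[symmetric]) auto
  also have "\<dots> \<le> card ?N" by (rule card_mono) auto
  finally have *: "real (\<Sum>t<?m. card {j \<in> hash_group n s h t. j \<le> i \<and> adj E i j}) \<le> real (card ?N)"
    by (simp only: of_nat_le_iff)
  have "(\<Sum>t<?m. pmf (published_bit n s \<epsilon> E i h t) True) \<le>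
     (\<Sum>t<?m. 1 / (real s * (exp \<epsilon> - 1)) + real (card {j \<in> hash_group n s h t. j \<le> i \<and> adj E i j}) / real s)"
    by (intro sum_mono pmf_published_bit_le assms)
  also have "\<dots> = real ?m / (real s * (exp \<epsilon> - 1))
      + real (\<Sum>t<?m. card {j \<in> hash_group n s h t. j \<le> i \<and> adj E i j}) / real s"
    by (simp add: sum.distrib sum_divide_distrib)
  also have "\<dots> \<le> real ?m / (real s * (exp \<epsilon> - 1)) + real (card ?N) / real s"
    by (intro add_left_mono divide_right_mono *) simp
  finally show ?thesis .
qed

lemma length_filter_upt: "length (filter P [0..<m]) = (\<Sum>t<m. of_bool (P t))"
  by (induction m) auto

text \<open>Linearity of expectation over the published bits, for each fixed hash; the bound is
  uniform in the hash and so survives averaging. Nonnegative integrals avoid integrability side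
  conditions.\<close>

lemma expected_message_length_le:
  assumes "0 < s" "0 < \<epsilon>"
  shows "(\<integral>\<^sup>+w. ennreal (real (length w)) \<partial>user_message n s \<epsilon> E i) \<le>
    ennreal (real (num_groups n s) / (real s * (exp \<epsilon> - 1)) + real (card {j \<in> {1..n}. j \<le> i \<and> adj E i j}) / real s)"
    (is "_ \<le> ennreal ?B")
proof -
  let ?m = "num_groups n s"
  have bit: "(\<integral>\<^sup>+b. ennreal (of_bool b) \<partial>M) = ennreal (pmf M True)" for M :: "bool pmf"
    by (subst nn_integral_measure_pmf_support[of UNIV]) (auto simp: UNIV_bool)
  have inner: "(\<integral>\<^sup>+a. ennreal (real (length (filter a [0..<?m]))) \<partial>Pi_pmf {..<?m} False (published_bit n s \<epsilon> E i h)) \<le> ennreal ?B"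
    if h: "h \<in> set_pmf (hash_params n)" for h
  proof -
    let ?P = "Pi_pmf {..<?m} False (published_bit n s \<epsilon> E i h)"
    have "(\<integral>\<^sup>+a. ennreal (real (length (filter a [0..<?m]))) \<partial>?P) =
        (\<integral>\<^sup>+a. (\<Sum>t<?m. ennreal (of_bool (a t))) \<partial>?P)"
      by (simp add: length_filter_upt sum_ennreal)
    also have "\<dots> = (\<Sum>t<?m. \<integral>\<^sup>+a. ennreal (of_bool (a t)) \<partial>?P)"
      by (rule nn_integral_sum) simp
    also have "\<dots> = (\<Sum>t<?m. \<integral>\<^sup>+b. ennreal (of_bool b) \<partial>map_pmf (\<lambda>a. a t) ?P)"
      by simp
    also have "\<dots> = (\<Sum>t<?m. ennreal (pmf (published_bit n s \<epsilon> E i h t) True))"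
      by (intro sum.cong refl, subst Pi_pmf_component) (auto simp: bit)
    also have "\<dots> = ennreal (\<Sum>t<?m. pmf (published_bit n s \<epsilon> E i h t) True)"
      by (simp add: sum_ennreal)
    also have "\<dots> \<le> ennreal ?B"
      by (intro ennreal_leI sum_pmf_published_bit_le assms h)
    finally show ?thesis .
  qed
  have "(\<integral>\<^sup>+w. ennreal (real (length w)) \<partial>user_message n s \<epsilon> E i) =
     (\<integral>\<^sup>+h. \<integral>\<^sup>+a. ennreal (real (length (filter a [0..<?m]))) \<partial>Pi_pmf {..<?m} False (published_bit n s \<epsilon> E i h) \<partial>hash_params n)"
    by (simp add: user_message_def)
  also have "\<dots> \<le> (\<integral>\<^sup>+h. ennreal ?B \<partial>hash_params n)"
    by (intro nn_integral_mono_AE AE_pmfI inner)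
  also have "\<dots> = ennreal ?B" by simp
  finally show ?thesis .
qed

section \<open>Total cost over all users\<close>

text \<open>With \<open>j \<le> i\<close>, an edge is charged to its larger endpoint alone: the
  ordered pair can be recovered from the set \<open>{i, j}\<close>.\<close>

lemma sum_lower_degrees_le:
  assumes "simple_graph n E"
  shows "(\<Sum>i\<in>{1..n}. card {j \<in> {1..n}. j \<le> i \<and> adj E i j}) \<le> card E"
proof -
  have "finite E"
    using assms by (intro finite_subset[of E "Pow {1..n}"]) (auto simp: simple_graph_def)
  have "(\<Sum>i\<in>{1..n}. card {j \<in> {1..n}. j \<le> i \<and> adj E i j}) =
      card (SIGMA i:{1..n}. {j \<in> {1..n}. j \<le> i \<and> adj E i j})"
    by simp
  also have "\<dots> \<le> card E"
  proof (rule card_inj_on_le)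
    show "inj_on (\<lambda>(i, j). {i, j}) (SIGMA i:{1..n}. {j \<in> {1..n}. j \<le> i \<and> adj E i j})"
      by (auto simp: inj_on_def doubleton_eq_iff)
  qed (use \<open>finite E\<close> in \<open>auto simp: adj_def\<close>)
  finally show ?thesis .
qed

lemma download_cost_le:
  assumes "0 < s" "0 < \<epsilon>" "simple_graph n E"
  shows "download_cost n s \<epsilon> E k \<le> real (nat \<lceil>log 2 (real (num_groups n s))\<rceil>) *
    (real (card E) / real s + real n * real (num_groups n s) / (real s * (exp \<epsilon> - 1)))"
proof -
  let ?m = "num_groups n s" and ?I = "{1..n} - {k}"
  define b where "b = nat \<lceil>log 2 (real ?m)\<rceil>"
  define d where "d i = card {j \<in> {1..n}. j \<le> i \<and> adj E i j}" for i
  define q where "q = real ?m / (real s * (exp \<epsilon> - 1))"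
  have q: "q \<ge> 0" using assms by (simp add: q_def)
  have "(\<integral>\<^sup>+w. ennreal (real (\<Sum>i\<in>?I. message_size n s (w i))) \<partial>group_rr n s \<epsilon> E) =
     (\<integral>\<^sup>+w. (\<Sum>i\<in>?I. ennreal (real b) * ennreal (real (length (w i)))) \<partial>group_rr n s \<epsilon> E)"
    by (simp add: message_size_def b_def sum_ennreal mult.commute flip: ennreal_mult)
  also have "\<dots> = (\<Sum>i\<in>?I. ennreal (real b) * (\<integral>\<^sup>+w. ennreal (real (length (w i))) \<partial>group_rr n s \<epsilon> E))"
    by (simp add: nn_integral_sum nn_integral_cmult)
  also have "\<dots> = (\<Sum>i\<in>?I. ennreal (real b) * (\<integral>\<^sup>+x. ennreal (real (length x)) \<partial>map_pmf (\<lambda>w. w i) (group_rr n s \<epsilon> E)))"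
    by simp
  also have "\<dots> = (\<Sum>i\<in>?I. ennreal (real b) * (\<integral>\<^sup>+x. ennreal (real (length x)) \<partial>user_message n s \<epsilon> E i))"
    unfolding group_rr_def by (intro sum.cong refl, subst Pi_pmf_component) auto
  also have "\<dots> \<le> (\<Sum>i\<in>?I. ennreal (real b) * ennreal (q + real (d i) / real s))"
    unfolding q_def d_def by (intro sum_mono mult_left_mono expected_message_length_le assms) auto
  \<comment> \<open>Putting the downloading user \<open>k\<close> back in gives a bound independent
    of \<open>k\<close>.\<close>
  also have "\<dots> \<le> (\<Sum>i\<in>{1..n}. ennreal (real b) * ennreal (q + real (d i) / real s))"
    by (intro sum_mono2) auto
  also have "\<dots> = ennreal (\<Sum>i\<in>{1..n}. real b * (q + real (d i) / real s))"
    using q by (simp add: sum_ennreal ennreal_mult'[symmetric] del: ennreal_plus)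
  \<comment> \<open>A finite bound on the nonnegative integral carries over to the real
    expectation.\<close>
  finally have "download_cost n s \<epsilon> E k \<le> (\<Sum>i\<in>{1..n}. real b * (q + real (d i) / real s))"
    unfolding download_cost_def using q
    by (intro integral_real_bounded sum_nonneg mult_nonneg_nonneg add_nonneg_nonneg) auto
  also have "\<dots> = real b * (real (\<Sum>i\<in>{1..n}. d i) / real s + real n * q)"
    by (simp add: sum_distrib_left[symmetric] sum.distrib sum_divide_distrib)
  also have "\<dots> \<le> real b * (real (card E) / real s + real n * q)"
    using sum_lower_degrees_le[OF assms(3)] unfolding d_def
    by (intro mult_left_mono add_right_mono divide_right_mono) (auto simp: of_nat_le_iff simp del: of_nat_sum)
  finally show ?thesis by (simp add: b_def q_def)
qed

section \<open>The asymptotic bound\<close>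

text \<open>\<open>\<kappa>\<close> keeps \<open>n / s\<close> away from 1. At \<open>n = s\<close>
  the logarithm vanishes, although there are at least two groups and an index still costs a
  bit.\<close>

theorem corollary1:
  fixes \<kappa> :: real
  assumes "1 < \<kappa>"
  shows "\<exists>C>0. \<forall>(n::nat) (s::nat) (\<epsilon>\<^sub>1::real) (E::nat set set) (k::nat).
           0 < s \<longrightarrow> \<kappa> \<le> real n / real s \<longrightarrow> 0 < \<epsilon>\<^sub>1 \<longrightarrow> simple_graph n E \<longrightarrow> k \<in> {1..n} \<longrightarrow>
           download_cost n s \<epsilon>\<^sub>1 E k \<le>
             C * (log 2 (real n / real s) *
               (real (card E) / real s + (real n)\<^sup>2 / ((real s)\<^sup>2 * (exp \<epsilon>\<^sub>1 - 1))))"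
proof -
  obtain K where K: "K > 0" "\<And>n. n > 0 \<Longrightarrow> real (next_prime n) \<le> K * real n"
    using next_prime_linear_bound by blast
  define l where "l = log 2 \<kappa>"
  \<comment> \<open>An index takes at most \<open>log 2 x + (log 2 (K + 1) + 1)\<close> bits, where
    \<open>x = n / s\<close>. Since \<open>log 2 x \<ge> l > 0\<close>, dividing the additive
    constant by \<open>l\<close> makes it a multiple of \<open>log 2 x\<close>.\<close>
  define A where "A = 1 + (log 2 (K + 1) + 1) / l"
  have l: "l > 0" using assms by (simp add: l_def)
  have K1: "log 2 (K + 1) > 0" using K by simp
  then have A: "A > 0" using l by (simp add: A_def add_pos_pos)
  show ?thesis
  \<comment> \<open>\<open>A\<close> pays for the bits per index, \<open>K + 1\<close> for the
    number of groups relative to \<open>n / s\<close>.\<close>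
  proof (intro exI[of _ "A * (K + 1)"] conjI allI impI)
    show "A * (K + 1) > 0" using A K by simp
  next
    fix n s :: nat and \<epsilon> :: real and E :: "nat set set" and k :: nat
    assume s: "0 < s" and ns: "\<kappa> \<le> real n / real s" and \<epsilon>: "0 < \<epsilon>"
      and E: "simple_graph n E" and k: "k \<in> {1..n}"
    define x where "x = real n / real s"
    define m where "m = real (num_groups n s)"
    define D where "D = exp \<epsilon> - 1"
    have D: "D > 0" using \<epsilon> by (simp add: D_def)
    have x: "x > 1" "\<kappa> \<le> x" using ns assms by (auto simp: x_def)
    have lx: "l \<le> log 2 x" using x assms by (simp add: l_def)
    have "m \<le> real (next_prime n) / real s + 1"
      unfolding m_def num_groups_def by (simp add: of_nat_nat)
    also have "\<dots> \<le> K * real n / real s + 1"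
      using K(2)[of n] k by (intro add_right_mono divide_right_mono) auto
    also have "\<dots> = K * x + 1" by (simp add: x_def)
    \<comment> \<open>The 1 from rounding up is absorbed because \<open>x > 1\<close>.\<close>
    also have "\<dots> \<le> (K + 1) * x" using x by (simp add: distrib_right)
    finally have m: "m \<le> (K + 1) * x" .
    have m1: "m \<ge> 1" using num_groups_pos[OF s, of n] by (simp add: m_def)
    have "real (nat \<lceil>log 2 m\<rceil>) \<le> log 2 m + 1" using m1 by (simp add: of_nat_nat)
    also have "\<dots> \<le> log 2 ((K + 1) * x) + 1" using m m1 by simp
    also have "\<dots> = log 2 x + (log 2 (K + 1) + 1) * 1" using K x by (simp add: log_mult)
    also have "\<dots> \<le> log 2 x + (log 2 (K + 1) + 1) * (log 2 x / l)"
      using lx l K1 by (intro add_left_mono mult_left_mono) auto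
    also have "\<dots> = A * log 2 x" by (simp add: A_def field_simps)
    finally have bits: "real (nat \<lceil>log 2 m\<rceil>) \<le> A * log 2 x" .
    have "real n * m / (real s * D) \<le> real n * ((K + 1) * x) / (real s * D)"
      using m D by (intro divide_right_mono mult_left_mono) auto
    also have "\<dots> = (K + 1) * ((real n)\<^sup>2 / ((real s)\<^sup>2 * D))"
      by (simp add: x_def power2_eq_square mult_ac)
    finally have noise: "real n * m / (real s * D) \<le> (K + 1) * ((real n)\<^sup>2 / ((real s)\<^sup>2 * D))" .
    have edges: "real (card E) / real s \<le> (K + 1) * (real (card E) / real s)"
      using K mult_right_mono[of 1 "K + 1" "real (card E) / real s"] by simp
    have "download_cost n s \<epsilon> E k \<le>
        real (nat \<lceil>log 2 m\<rceil>) * (real (card E) / real s + real n * m / (real s * D))"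
      using download_cost_le[OF s \<epsilon> E] by (simp add: m_def D_def)
    also have "\<dots> \<le> (A * log 2 x) *
        ((K + 1) * (real (card E) / real s) + (K + 1) * ((real n)\<^sup>2 / ((real s)\<^sup>2 * D)))"
      using bits noise edges A x D m1 by (intro mult_mono add_mono) auto
    also have "\<dots> = A * (K + 1) * (log 2 x * (real (card E) / real s + (real n)\<^sup>2 / ((real s)\<^sup>2 * D)))"
      unfolding distrib_left[symmetric] by (simp only: mult_ac)
    finally show "download_cost n s \<epsilon> E k \<le> A * (K + 1) * (log 2 (real n / real s) *
        (real (card E) / real s + (real n)\<^sup>2 / ((real s)\<^sup>2 * (exp \<epsilon> - 1))))"
      by (simp only: x_def D_def)
  qed
qed

end
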